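(* Let $G=(N,E)$ be a simple hypergraph on $N=[n]$, let $\mathcal{A}_G$ be its connected hypersubgraph arrangement, and let $\mathcal{F}_{\mathcal{A}_G}$ be the set of index sets $I$ such that $H_I\in\mathcal{A}_G$. Then $\mathcal{F}_{\mathcal{A}_G}$ is a building set in the Boolean lattice $2^{[n]}$.
   Context: A simple hypergraph $G=(N,E)$ has vertex set $N=[n]=\{1,\dots,n\}$ ($n\ge 1$) and edge set $E\subseteq 2^N$. For $\emptyset\neq I\subseteq N$ the induced hypersubgraph is $G[I]=(I,\{e\in E\mid e\subseteq I\})$. Two vertices $u,v$ are adjacent via $e\in E$ if $\{u,v\}\subseteq e$. A $(u,v)$-walk of length $k\geq 0$ is a sequence $v_1e_1v_2e_2\dots e_kv_{k+1}$ with $v_1=u$, $v_{k+1}=v$, $e_i\in E$, and $v_i,v_{i+1}$ adjacent via $e_i$; it is a path if all its vertices and all its edges are distinct. $G$ is connected if for all $u,v\in N$ there is a $(u,v)$-path (so a one-vertex hypergraph is connected, via the path of length $0$). For $\emptyset\ne I\subseteq N$ let $H_I=\ker\sum_{i\in I}x_i\subset\mathbb{Q}^n$. The connected hypersubgraph arrangement is $\mathcal{A}_G=\{H_I\mid \emptyset\neq I\subseteq N,\ G[I]\text{ is connected}\}$. A family $\mathcal{F}$ of nonempty subsets of $[n]$ is a building set in the Boolean lattice $2^{[n]}$ if it contains all singletons $\{i\}$, $i\in[n]$, and whenever $F,F'\in\mathcal{F}$ with $F\cap F'\neq\emptyset$, then $F\cup F'\in\mathcal{F}$. *)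

theory Defs
  imports Complex_Main "HOL-Library.FuncSet"
begin

(* A hypergraph is a pair (vertices, edges).  Edges form a set, so there are no
   repeated edges; the empty edge and singleton edges are allowed. *)
type_synonym hypergraph = "nat set \<times> nat set set"

abbreviation verts :: "hypergraph \<Rightarrow> nat set" where
  "verts G \<equiv> fst G"

abbreviation edges :: "hypergraph \<Rightarrow> nat set set" where
  "edges G \<equiv> snd G"

definition simple_hypergraph :: "nat \<Rightarrow> hypergraph \<Rightarrow> bool" where
  "simple_hypergraph n G \<longleftrightarrow> n \<ge> 1 \<and> verts G = {1..n} \<and> edges G \<subseteq> Pow (verts G)"

definition induced :: "hypergraph \<Rightarrow> nat set \<Rightarrow> hypergraph" where
  "induced G I = (I, {e \<in> edges G. e \<subseteq> I})"

definition adjacent_via :: "hypergraph \<Rightarrow> nat \<Rightarrow> nat set \<Rightarrow> nat \<Rightarrow> bool" where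
  "adjacent_via G u e v \<longleftrightarrow> u \<in> verts G \<and> v \<in> verts G \<and> e \<in> edges G \<and> {u, v} \<subseteq> e"

(* The walk v_1 e_1 v_2 ... e_k v_(k+1) is given by its vertex list
   vs = [v_1, ..., v_(k+1)] and its edge list es = [e_1, ..., e_k]. *)
definition is_walk :: "hypergraph \<Rightarrow> nat \<Rightarrow> nat list \<Rightarrow> nat set list \<Rightarrow> nat \<Rightarrow> bool" where
  "is_walk G u vs es v \<longleftrightarrow>
     length vs = length es + 1 \<and> set vs \<subseteq> verts G \<and> set es \<subseteq> edges G \<and>
     vs ! 0 = u \<and> vs ! length es = v \<and>
     (\<forall>i < length es. adjacent_via G (vs ! i) (es ! i) (vs ! (i + 1)))"

definition is_path :: "hypergraph \<Rightarrow> nat \<Rightarrow> nat list \<Rightarrow> nat set list \<Rightarrow> nat \<Rightarrow> bool" where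
  "is_path G u vs es v \<longleftrightarrow> is_walk G u vs es v \<and> distinct vs \<and> distinct es"

definition hconnected :: "hypergraph \<Rightarrow> bool" where
  "hconnected G \<longleftrightarrow> (\<forall>u \<in> verts G. \<forall>v \<in> verts G. \<exists>vs es. is_path G u vs es v)"

(* Rational n-space with coordinates indexed by 1, ..., n; extensionality makes a
   vector determined by these n coordinates. *)
definition rat_space :: "nat \<Rightarrow> (nat \<Rightarrow> rat) set" where
  "rat_space n = {1..n} \<rightarrow>\<^sub>E UNIV"

definition hyperplane :: "nat \<Rightarrow> nat set \<Rightarrow> (nat \<Rightarrow> rat) set" where
  "hyperplane n I = {x \<in> rat_space n. (\<Sum>i\<in>I. x i) = 0}"

definition connected_hypersubgraph_arrangement ::
    "nat \<Rightarrow> hypergraph \<Rightarrow> (nat \<Rightarrow> rat) set set" where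
  "connected_hypersubgraph_arrangement n G =
     {hyperplane n I | I. I \<noteq> {} \<and> I \<subseteq> verts G \<and> hconnected (induced G I)}"

definition index_family :: "nat \<Rightarrow> (nat \<Rightarrow> rat) set set \<Rightarrow> nat set set" where
  "index_family n A = {I. I \<noteq> {} \<and> I \<subseteq> {1..n} \<and> hyperplane n I \<in> A}"

definition building_set :: "nat \<Rightarrow> nat set set \<Rightarrow> bool" where
  "building_set n F \<longleftrightarrow>
     F \<subseteq> Pow {1..n} - {{}} \<and>
     (\<forall>i \<in> {1..n}. {i} \<in> F) \<and>
     (\<forall>S \<in> F. \<forall>T \<in> F. S \<inter> T \<noteq> {} \<longrightarrow> S \<union> T \<in> F)"

end

theory Submission
  imports Defs
begin

text \<open>
  A hyperplane \<open>H\<^sub>I\<close> determines its index set: if \<open>I \<noteq> J\<close>, say with \<open>i \<in> I - J\<close>, then the unit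
  vector at \<open>i\<close> lies in \<open>H\<^sub>J\<close> but not in \<open>H\<^sub>I\<close>. Hence the index family consists exactly of the nonempty vertex
  sets with connected induced hypersubgraph (\<open>index_family_arrangement\<close>), and the building set
  axioms become statements about connectivity. A single vertex is connected by the path of length
  \<open>0\<close>. If \<open>S\<close> and \<open>T\<close> are connected and share a vertex \<open>w\<close>, then any two vertices of \<open>S \<union> T\<close> are
  joined by a walk through \<open>w\<close>, because an edge inside \<open>S\<close> or inside \<open>T\<close> is also an edge inside
  \<open>S \<union> T\<close>.

  The walk through \<open>w\<close> may repeat vertices and edges, whereas connectivity asks for paths.
  The two notions are reconciled once and for all by \<open>hconnected_iff_reachable\<close>, which replaces
  paths by the reflexive transitive closure of adjacency; its core is the fact that a path can be
  prolonged to any neighbour of its last vertex after possibly cutting off a tail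
  (\<open>path_extend\<close>).
\<close>

definition adj :: "hypergraph \<Rightarrow> (nat \<times> nat) set" where
  "adj G = {(u, v). \<exists>e. adjacent_via G u e v}"

lemma walk_reachable:
  assumes "is_walk G u vs es v"
  shows "(u, v) \<in> (adj G)\<^sup>*"
proof -
  have "k \<le> length es \<Longrightarrow> (vs ! 0, vs ! k) \<in> (adj G)\<^sup>*" for k
  proof (induction k)
    case (Suc k)
    then have "(vs ! k, vs ! Suc k) \<in> adj G"
      using assms unfolding is_walk_def adj_def by (metis (mono_tags, lifting) Suc_eq_plus1
          Suc_le_lessD case_prodI mem_Collect_eq)
    with Suc show ?case by (auto intro: rtrancl_into_rtrancl)
  qed simp
  with assms show ?thesis by (auto simp: is_walk_def)
qed

lemma path_prefix:
  assumes "is_path G u vs es v" and "i \<le> length es"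
  shows "is_path G u (take (Suc i) vs) (take i es) (vs ! i)"
  using assms unfolding is_path_def is_walk_def
  by (auto dest: in_set_takeD)

lemma path_snoc:
  assumes "is_path G u vs es v" and "adjacent_via G v e w"
    and "w \<notin> set vs" and "e \<notin> set es"
  shows "is_path G u (vs @ [w]) (es @ [e]) w"
  using assms unfolding is_path_def is_walk_def adjacent_via_def
  by (auto simp: nth_append less_Suc_eq)

text \<open>
  If the new vertex already lies on the path, the prefix ending there is a path to it. If instead
  the new edge has been used, in step \<open>i\<close> say, then it also contains the vertex at position \<open>i\<close>,
  so step \<open>i\<close> can lead directly to the new vertex and everything after it can be dropped.
\<close>

lemma path_extend:
  assumes path: "is_path G u vs es v" and step: "adjacent_via G v e w"
  shows "\<exists>vs' es'. is_path G u vs' es' w"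
proof (cases "w \<in> set vs")
  case True
  then obtain i where "i < length vs" "vs ! i = w"
    by (auto simp: in_set_conv_nth)
  moreover have "length vs = Suc (length es)"
    using path by (simp add: is_path_def is_walk_def)
  ultimately show ?thesis
    using path_prefix[OF path, of i] by auto
next
  case new_vertex: False
  show ?thesis
  proof (cases "e \<in> set es")
    case True
    then obtain i where i: "i < length es" "es ! i = e"
      by (auto simp: in_set_conv_nth)
    have prefix: "is_path G u (take (Suc i) vs) (take i es) (vs ! i)"
      using path_prefix[OF path] i by simp
    have "adjacent_via G (vs ! i) e w"
      using path step i by (auto simp: is_path_def is_walk_def adjacent_via_def)
    moreover have "w \<notin> set (take (Suc i) vs)"
      using new_vertex by (auto dest: in_set_takeD)
    moreover have "e \<notin> set (take i es)"
      using path i by (auto simp: is_path_def in_set_conv_nth nth_eq_iff_index_eq)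
    ultimately show ?thesis
      using path_snoc[OF prefix] by blast
  next
    case False
    then show ?thesis
      using path_snoc[OF path step new_vertex] by blast
  qed
qed

lemma reachable_path:
  assumes "(u, v) \<in> (adj G)\<^sup>*" and "u \<in> verts G"
  shows "\<exists>vs es. is_path G u vs es v"
  using assms(1)
proof (induction rule: rtrancl_induct)
  case base
  have "is_path G u [u] [] u"
    using assms(2) by (simp add: is_path_def is_walk_def)
  then show ?case by blast
next
  case (step v w)
  then show ?case
    unfolding adj_def by (blast intro: path_extend)
qed

lemma hconnected_iff_reachable:
  "hconnected G \<longleftrightarrow> (\<forall>u \<in> verts G. \<forall>v \<in> verts G. (u, v) \<in> (adj G)\<^sup>*)"
  unfolding hconnected_def
  using walk_reachable reachable_path by (meson is_path_def)

lemma verts_induced [simp]: "verts (induced G I) = I"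
  by (simp add: induced_def)

lemma adj_induced_mono:
  assumes "S \<subseteq> T"
  shows "adj (induced G S) \<subseteq> adj (induced G T)"
  using assms by (auto simp: adj_def adjacent_via_def induced_def)

lemma hconnected_induced_singleton: "hconnected (induced G {i})"
  by (simp add: hconnected_iff_reachable)

lemma hconnected_induced_Un:
  assumes S: "hconnected (induced G S)" and T: "hconnected (induced G T)"
    and "S \<inter> T \<noteq> {}"
  shows "hconnected (induced G (S \<union> T))"
proof -
  let ?R = "(adj (induced G (S \<union> T)))\<^sup>*"
  obtain w where w: "w \<in> S" "w \<in> T"
    using assms(3) by blast
  have "(adj (induced G S))\<^sup>* \<subseteq> ?R" "(adj (induced G T))\<^sup>* \<subseteq> ?R"
    by (intro rtrancl_mono adj_induced_mono; blast)+
  then have "(u, w) \<in> ?R \<and> (w, u) \<in> ?R" if "u \<in> S \<union> T" for u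
    using that w S T unfolding hconnected_iff_reachable verts_induced by blast
  then show ?thesis
    unfolding hconnected_iff_reachable verts_induced by (meson rtrancl_trans)
qed

text \<open>
  The unit vector at an index \<open>i \<in> I - J\<close> would violate the inclusion. It is restricted to
  \<open>{1..n}\<close> because the vectors of \<^term>\<open>rat_space n\<close> are extensional functions.
\<close>

lemma hyperplane_subset_imp_index_subset:
  assumes "I \<subseteq> {1..n}" and "J \<subseteq> {1..n}" and sub: "hyperplane n J \<subseteq> hyperplane n I"
  shows "I \<subseteq> J"
proof
  fix i assume i: "i \<in> I"
  define x :: "nat \<Rightarrow> rat" where
    "x = restrict (\<lambda>k. if k = i then 1 else 0) {1..n}"
  have sum_x: "(\<Sum>k\<in>K. x k) = (if i \<in> K then 1 else 0)" if K: "K \<subseteq> {1..n}" for K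
  proof -
    have "(\<Sum>k\<in>K. x k) = (\<Sum>k\<in>K. if k = i then 1 else 0)"
      using K by (intro sum.cong) (auto simp: x_def)
    with finite_subset[OF K] show ?thesis by simp
  qed
  have "x \<in> rat_space n"
    by (simp add: x_def rat_space_def)
  moreover have "x \<notin> hyperplane n I"
    using sum_x[OF assms(1)] i by (simp add: hyperplane_def)
  ultimately show "i \<in> J"
    using sum_x[OF assms(2)] sub by (auto simp: hyperplane_def split: if_splits)
qed

lemma index_family_arrangement:
  assumes "verts G = {1..n}"
  shows "index_family n (connected_hypersubgraph_arrangement n G) =
    {I. I \<noteq> {} \<and> I \<subseteq> {1..n} \<and> hconnected (induced G I)}"
proof -
  have "I = J" if "I \<subseteq> {1..n}" "J \<subseteq> {1..n}" "hyperplane n I = hyperplane n J" for I J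
    using that hyperplane_subset_imp_index_subset by (metis order_refl subset_antisym)
  then show ?thesis
    using assms unfolding index_family_def connected_hypersubgraph_arrangement_def by blast
qed

theorem lemma1p3:
  fixes n :: nat and G :: hypergraph
  assumes "simple_hypergraph n G"
  shows "building_set n (index_family n (connected_hypersubgraph_arrangement n G))"
proof -
  have "verts G = {1..n}"
    using assms by (simp add: simple_hypergraph_def)
  then show ?thesis
    unfolding building_set_def
    by (auto simp: index_family_arrangement hconnected_induced_singleton hconnected_induced_Un)
qed

end
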